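(* Let $q \in \mathbb{R}$ with $q \neq 1$, let $\beta \in [0,1]$, and let $\pi_0, \tilde{\pi}_1$ be strictly positive density functions ($\tilde{\pi}_1$ possibly unnormalized) on a common space. Define $$\tilde{\pi}_{\beta,q}(z) = \Big[(1-\beta)\,\pi_0(z)^{1-q} + \beta\,\tilde{\pi}_1(z)^{1-q}\Big]^{\frac{1}{1-q}}.$$ Then for every $z$, $$\tilde{\pi}_{\beta,q}(z) = \pi_0(z)\,\exp_q\!\left\{\beta \cdot \ln_q\!\left(\frac{\tilde{\pi}_1(z)}{\pi_0(z)}\right)\right\}.$$ That is, the $q$-path densities form an (unnormalized) $q$-exponential family with base measure $\pi_0$, natural parameter $\beta$ and sufficient statistic $T(z) = \ln_q\big(\tilde{\pi}_1(z)/\pi_0(z)\big)$.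
   Context: For $q \neq 1$, the $q$-logarithm is $\ln_q(u) = \frac{1}{1-q}\left(u^{1-q} - 1\right)$ for $u>0$, and the $q$-exponential is $\exp_q(u) = \big[1 + (1-q)\,u\big]_{+}^{\frac{1}{1-q}}$, where $[x]_+ = \max\{0,x\}$. An unnormalized $q$-exponential family with base measure $g$, natural parameter $\theta$ and sufficient statistic $\phi$ is a family of functions of the form $g(z)\exp_q\{\theta\cdot\phi(z)\}$. *)

theory Defs
  imports "HOL-Analysis.Analysis"
begin

text \<open>All notions below are meant for \<^term>\<open>q \<noteq> (1::real)\<close>; the deformed logarithm is meant for
  \<^term>\<open>u > (0::real)\<close>.\<close>

definition ln_q :: "real \<Rightarrow> real \<Rightarrow> real" where
  "ln_q q u = (1 / (1 - q)) * (u powr (1 - q) - 1)"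

text \<open>For \<^term>\<open>q > (1::real)\<close> the exponent is negative, and where the bracket vanishes the usual value
  is infinite, whereas \<^term>\<open>0 powr a = (0::real)\<close> makes it 0 here. The bracket is strictly
  positive at every argument of the form \<^term>\<open>\<beta> * ln_q q u\<close> with \<^term>\<open>u > (0::real)\<close> and
  \<^term>\<open>\<beta>\<close> between 0 and 1.\<close>

definition exp_q :: "real \<Rightarrow> real \<Rightarrow> real" where
  "exp_q q u = (max 0 (1 + (1 - q) * u)) powr (1 / (1 - q))"

text \<open>No bound is put on the total mass of an unnormalized density.\<close>

definition pos_unnormalized_density :: "'a measure \<Rightarrow> ('a \<Rightarrow> real) \<Rightarrow> bool" where
  "pos_unnormalized_density M f \<longleftrightarrow> f \<in> borel_measurable M \<and> (\<forall>z\<in>space M. f z > 0)"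

definition pos_density :: "'a measure \<Rightarrow> ('a \<Rightarrow> real) \<Rightarrow> bool" where
  "pos_density M f \<longleftrightarrow> pos_unnormalized_density M f \<and> (\<integral>\<^sup>+ z. ennreal (f z) \<partial>M) = 1"

definition q_path :: "real \<Rightarrow> ('a \<Rightarrow> real) \<Rightarrow> ('a \<Rightarrow> real) \<Rightarrow> real \<Rightarrow> 'a \<Rightarrow> real" where
  "q_path q p0 p1 \<beta> z =
     ((1 - \<beta>) * p0 z powr (1 - q) + \<beta> * p1 z powr (1 - q)) powr (1 / (1 - q))"

text \<open>The family \<^term>\<open>p\<close> is indexed by the natural parameter, which ranges over \<^term>\<open>\<Theta>\<close>;
  \<^term>\<open>g\<close> is the base measure and \<^term>\<open>\<phi>\<close> the sufficient statistic.\<close>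

definition unnormalized_q_exp_family ::
  "real \<Rightarrow> 'a set \<Rightarrow> 'b::real_inner set \<Rightarrow> ('a \<Rightarrow> real) \<Rightarrow> ('a \<Rightarrow> 'b) \<Rightarrow> ('b \<Rightarrow> 'a \<Rightarrow> real) \<Rightarrow> bool" where
  "unnormalized_q_exp_family q Z \<Theta> g \<phi> p \<longleftrightarrow>
     (\<forall>\<theta>\<in>\<Theta>. \<forall>z\<in>Z. p \<theta> z = g z * exp_q q (\<theta> \<bullet> \<phi> z))"

end

(* Factoring pi0^(1-q) out of the bracket leaves 1 - beta + beta * (pi1/pi0)^(1-q), which is
   1 + (1-q) * (beta * ln_q (pi1/pi0)).  It is a convex combination of positive numbers, so the
   truncation in exp_q is inactive. *)
theory Submission
  imports Defs
begin

text \<open>The factor \<open>1 - q\<close> cancels the prefactor of \<open>ln_q\<close>, so the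
  bracket interpolates linearly between 1 and \<open>u powr (1 - q)\<close> as \<beta> runs from 0
  to 1.\<close>

lemma exp_q_scaled_ln_q:
  assumes "q \<noteq> 1" "0 \<le> \<beta>" "\<beta> \<le> 1" "0 < u"
  shows "exp_q q (\<beta> * ln_q q u) = (1 - \<beta> + \<beta> * u powr (1 - q)) powr (1 / (1 - q))"
proof -
  have "(1 - q) * (\<beta> * ln_q q u) = \<beta> * (u powr (1 - q) - 1)"
    using assms(1) by (simp add: ln_q_def)
  then have "1 + (1 - q) * (\<beta> * ln_q q u) = 1 - \<beta> + \<beta> * u powr (1 - q)"
    by (simp add: algebra_simps)
  moreover have "0 \<le> 1 - \<beta> + \<beta> * u powr (1 - q)"
    using assms by simp
  ultimately show ?thesis
    by (simp only: exp_q_def max.absorb2)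
qed

lemma q_path_eq_exp_q:
  assumes "q \<noteq> 1" "0 \<le> \<beta>" "\<beta> \<le> 1" "0 < p0 z" "0 < p1 z"
  shows "q_path q p0 p1 \<beta> z = p0 z * exp_q q (\<beta> * ln_q q (p1 z / p0 z))"
proof -
  define r where "r = p1 z / p0 z"
  have r: "0 < r" "p1 z = p0 z * r"
    using assms by (simp_all add: r_def)
  have "p1 z powr (1 - q) = p0 z powr (1 - q) * r powr (1 - q)"
    using r assms by (simp add: powr_mult)
  then have "(1 - \<beta>) * p0 z powr (1 - q) + \<beta> * p1 z powr (1 - q)
      = p0 z powr (1 - q) * (1 - \<beta> + \<beta> * r powr (1 - q))"
    by (simp add: algebra_simps)
  \<comment> \<open>The outer power is split over a product of nonnegative factors; this gives the
    sign of the second one.\<close>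
  moreover have "0 \<le> 1 - \<beta> + \<beta> * r powr (1 - q)"
    using assms by simp
  ultimately have "q_path q p0 p1 \<beta> z = (p0 z powr (1 - q)) powr (1 / (1 - q))
      * (1 - \<beta> + \<beta> * r powr (1 - q)) powr (1 / (1 - q))"
    by (simp add: q_path_def powr_mult)
  \<comment> \<open>The exponents multiply to 1 since \<open>q \<noteq> 1\<close>, and
    \<open>p0 z powr 1 = p0 z\<close> since \<open>p0 z\<close> is positive.\<close>
  also have "(p0 z powr (1 - q)) powr (1 / (1 - q)) = p0 z"
    using assms by (simp add: powr_powr)
  finally show ?thesis
    using exp_q_scaled_ln_q[OF assms(1-3) r(1)] by (simp add: r_def)
qed

theorem mainTheorem2:
  fixes q \<beta> :: real
    and M :: "'a measure"
    and \<pi>0 \<pi>1 :: "'a \<Rightarrow> real"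
  assumes "q \<noteq> 1"
    and "\<beta> \<in> {0..1}"
    and "pos_density M \<pi>0"
    and "pos_unnormalized_density M \<pi>1"
  shows "(\<forall>z\<in>space M. q_path q \<pi>0 \<pi>1 \<beta> z = \<pi>0 z * exp_q q (\<beta> * ln_q q (\<pi>1 z / \<pi>0 z))) \<and>
    unnormalized_q_exp_family q (space M) {0..1} \<pi>0 (\<lambda>z. ln_q q (\<pi>1 z / \<pi>0 z)) (q_path q \<pi>0 \<pi>1)"
proof -
  \<comment> \<open>Proved for every \<open>b\<close> in the unit interval: the identity at \<beta>
    is one instance, while the family claim ranges over all parameters.\<close>
  have "q_path q \<pi>0 \<pi>1 b z = \<pi>0 z * exp_q q (b * ln_q q (\<pi>1 z / \<pi>0 z))"
    if "b \<in> {0..1}" "z \<in> space M" for b z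
    using assms that
    by (intro q_path_eq_exp_q) (auto simp: pos_density_def pos_unnormalized_density_def)
  then show ?thesis
    \<comment> \<open>On the reals the inner product \<open>\<theta> \<bullet> \<phi> z\<close> is
      ordinary multiplication.\<close>
    using assms(2) by (simp add: unnormalized_q_exp_family_def)
qed

end
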